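(* Let $A$ be a path-connected space with a subset $B\subset A$, and let $n\ge 1$. Then $\mathrm{TC}_n(A,B)\le \mathrm{TC}_n(A)$.
   Context: For continuous maps $f_1,\dots,f_m : W\to V$, the higher homotopic distance $\mathrm{D}(f_1,\dots,f_m)$ is the least positive integer $r$ such that $W$ has an open cover $\{W_1,\dots,W_r\}$ with $f_1|_{W_i}\simeq f_2|_{W_i}\simeq\cdots\simeq f_m|_{W_i}$ (as maps $W_i\to V$) for every $i$ (and $\infty$ if no such $r$ exists); for a single map ($m=1$) it is $1$. Let $p_i : A^{n}\to A$ be the projection onto the $i$-th factor. The higher topological complexity of a path-connected space $A$ is $\mathrm{TC}_n(A)=\mathrm{D}(p_1,\dots,p_n)$. For $B\subseteq A$ and $n>1$, the relative higher topological complexity of the pair $(A,B)$ is (homotopic distance definition) $\mathrm{TC}_n(A,B)=\mathrm{D}(p_1|_Y,\dots,p_n|_Y)$, where $Y=A\times B\times\cdots\times B\subseteq A^{n}$ (with $n-1$ factors $B$). By convention $\mathrm{TC}_1(A,B)=1$. *)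

theory Defs
  imports "HOL-Analysis.Analysis" "HOL-Library.Extended_Nat"
begin

text \<open>
  Maps \<open>f 1, \<dots>, f m\<close> from \<open>W\<close> to \<open>V\<close> are given as a family indexed by \<open>{1..m}\<close>. The restriction of
  \<open>f j\<close> to a subset \<open>U\<close> of \<open>W\<close> is \<open>f j\<close> itself, with domain the subspace \<open>subtopology W U\<close>.
\<close>

definition admits_homotopic_cover ::
  "nat \<Rightarrow> 'a topology \<Rightarrow> 'b topology \<Rightarrow> (nat \<Rightarrow> 'a \<Rightarrow> 'b) \<Rightarrow> nat \<Rightarrow> bool" where
  "admits_homotopic_cover m W V f r \<longleftrightarrow>
     (\<exists>U. (\<forall>i\<in>{1..r}. openin W (U i)) \<and> (\<Union>i\<in>{1..r}. U i) = topspace W \<and>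
          (\<forall>i\<in>{1..r}. \<forall>j\<in>{1..<m}.
             homotopic_with (\<lambda>_. True) (subtopology W (U i)) V (f j) (f (Suc j))))"

text \<open>
  In \<open>enat\<close> the infimum of a nonempty set is its least element, and the infimum of the empty set
  is \<open>\<infinity>\<close>.
\<close>

definition homotopic_distance ::
  "nat \<Rightarrow> 'a topology \<Rightarrow> 'b topology \<Rightarrow> (nat \<Rightarrow> 'a \<Rightarrow> 'b) \<Rightarrow> enat" where
  "homotopic_distance m W V f = Inf {enat r | r. r \<ge> 1 \<and> admits_homotopic_cover m W V f r}"

text \<open>The convention for a single map is a consequence of the definition.\<close>

lemma homotopic_distance_single: "homotopic_distance 1 W V f = 1"
proof -
  have "admits_homotopic_cover 1 W V f 1"
    unfolding admits_homotopic_cover_def by (intro exI[of _ "\<lambda>_. topspace W"]) auto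
  then have "homotopic_distance 1 W V f \<le> enat 1"
    unfolding homotopic_distance_def by (intro Inf_lower) blast
  moreover have "enat 1 \<le> homotopic_distance 1 W V f"
    unfolding homotopic_distance_def by (intro Inf_greatest) auto
  ultimately show ?thesis
    by (simp add: one_enat_def)
qed

definition power_space :: "nat \<Rightarrow> 'a topology \<Rightarrow> (nat \<Rightarrow> 'a) topology" where
  "power_space n A = product_topology (\<lambda>_. A) {1..n}"

definition proj :: "nat \<Rightarrow> (nat \<Rightarrow> 'a) \<Rightarrow> 'a" where
  "proj i x = x i"

definition higher_TC :: "nat \<Rightarrow> 'a topology \<Rightarrow> enat" where
  "higher_TC n A = homotopic_distance n (power_space n A) A proj"

definition relative_domain :: "nat \<Rightarrow> 'a topology \<Rightarrow> 'a set \<Rightarrow> (nat \<Rightarrow> 'a) set" where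
  "relative_domain n A B = (\<Pi>\<^sub>E i\<in>{1..n}. if i = 1 then topspace A else B)"

definition relative_higher_TC :: "nat \<Rightarrow> 'a topology \<Rightarrow> 'a set \<Rightarrow> enat" where
  "relative_higher_TC n A B =
     (if n = 1 then 1
      else homotopic_distance n (subtopology (power_space n A) (relative_domain n A B)) A proj)"

end

theory Submission
  imports Defs
begin

text \<open>Homotopic distance cannot grow when the maps are restricted to a subspace: intersecting
  each member of an open cover with \<open>S\<close> gives an open cover of \<open>S\<close> with
  equally many members, and the homotopies restrict. The relative invariant for \<open>n\<close> > 1
  is the distance of the projections on a subspace of the power of \<open>A\<close>, so
  \<open>homotopic_distance_subtopology\<close> bounds it by the absolute one.\<close>

lemma admits_homotopic_cover_subtopology:
  assumes "admits_homotopic_cover m W V f r"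
  shows "admits_homotopic_cover m (subtopology W S) V f r"
proof -
  obtain U where opn: "\<forall>i\<in>{1..r}. openin W (U i)"
    and cover: "(\<Union>i\<in>{1..r}. U i) = topspace W"
    and hom: "\<forall>i\<in>{1..r}. \<forall>j\<in>{1..<m}.
      homotopic_with (\<lambda>_. True) (subtopology W (U i)) V (f j) (f (Suc j))"
    using assms unfolding admits_homotopic_cover_def by blast
  have "openin (subtopology W S) (S \<inter> U i)" if "i \<in> {1..r}" for i
    using opn that by (simp add: openin_subtopology_Int2)
  moreover have "(\<Union>i\<in>{1..r}. S \<inter> U i) = topspace (subtopology W S)"
    using cover by auto
  moreover have "homotopic_with (\<lambda>_. True) (subtopology (subtopology W S) (S \<inter> U i)) V
      (f j) (f (Suc j))" if "i \<in> {1..r}" "j \<in> {1..<m}" for i j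
  proof -
    \<comment> \<open>Viewing the new member as a subspace of \<open>U i\<close> instead of
      \<open>S\<close> lets the homotopy given on \<open>U i\<close> be restricted to it.\<close>
    have "subtopology (subtopology W S) (S \<inter> U i) = subtopology (subtopology W (U i)) S"
      by (simp add: subtopology_subtopology Int_ac)
    then show ?thesis
      using homotopic_from_subtopology[OF hom[rule_format, OF that]] by simp
  qed
  ultimately show ?thesis
    unfolding admits_homotopic_cover_def by (intro exI[of _ "\<lambda>i. S \<inter> U i"]) blast
qed

text \<open>Every length \<open>r\<close> admissible for \<open>W\<close> is admissible for the
  subspace, and the infimum over a larger set is smaller; the value \<infinity> needs no separate
  case.\<close>

lemma homotopic_distance_subtopology:
  "homotopic_distance m (subtopology W S) V f \<le> homotopic_distance m W V f"
  unfolding homotopic_distance_def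
  by (intro Inf_superset_mono) (auto intro: admits_homotopic_cover_subtopology)

theorem proposition4p8:
  fixes A :: "'a topology" and B :: "'a set" and n :: nat
  assumes "path_connected_space A" and "B \<subseteq> topspace A" and "n \<ge> 1"
  shows "relative_higher_TC n A B \<le> higher_TC n A"
proof (cases "n = 1")
  case True
  then show ?thesis
    \<comment> \<open>Both sides equal 1, the left by convention and the right as the distance of a
      single map. The simplifier writes the index 1 as \<open>Suc 0\<close>, so the lemma is put in
      that form.\<close>
    by (simp add: relative_higher_TC_def higher_TC_def homotopic_distance_single[unfolded One_nat_def])
next
  case False
  then show ?thesis
    by (simp add: relative_higher_TC_def higher_TC_def homotopic_distance_subtopology)
qed

end
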